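(* Let $G=(V,E)$ be a graph that is $M$-connected in $\mathbb{R}^d$. Then $G$ is $M$-connected in $\mathbb{R}^{d'}$ for all $1\leq d'\leq d$.
   Context: For $p:V\to\mathbb{R}^k$ the rigidity matrix $R(G,p)$ is the $|E|\times k|V|$ matrix whose row for edge $uv$ has $p(u)-p(v)$ in the columns of $u$, $p(v)-p(u)$ in the columns of $v$, zeros elsewhere. The $k$-dimensional rigidity matroid $\mathcal{R}_k(G)$ on $E$ is defined by linear independence of rows of $R(G,p)$ for $p$ generic (coordinates algebraically independent over $\mathbb{Q}$). $G$ is $M$-connected in $\mathbb{R}^k$ if $\mathcal{R}_k(G)$ is connected, i.e.\ any two distinct edges lie in a common circuit of $\mathcal{R}_k(G)$. *)

theory Defs
  imports Complex_Main
begin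

definition simple_graph :: "'a set \<Rightarrow> 'a set set \<Rightarrow> bool" where
  "simple_graph V E \<longleftrightarrow> finite V \<and>
     (\<forall>e\<in>E. \<exists>u v. u \<in> V \<and> v \<in> V \<and> u \<noteq> v \<and> e = {u, v})"

text \<open>Algebraic independence over the rationals of the reals x i, i in a finite index set I:
  no nonzero rational polynomial in the variables indexed by I vanishes at x.
  A polynomial is given by a finite set M of exponent vectors (supported in I)
  and rational coefficients c.\<close>
definition alg_indep_rat :: "'b set \<Rightarrow> ('b \<Rightarrow> real) \<Rightarrow> bool" where
  "alg_indep_rat I x \<longleftrightarrow>
     (\<forall>(M :: ('b \<Rightarrow> nat) set) (c :: ('b \<Rightarrow> nat) \<Rightarrow> rat).
        finite M \<longrightarrow> (\<forall>m\<in>M. \<forall>i. i \<notin> I \<longrightarrow> m i = 0) \<longrightarrow>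
        (\<Sum>m\<in>M. of_rat (c m) * (\<Prod>i\<in>I. x i ^ m i)) = 0 \<longrightarrow>
        (\<forall>m\<in>M. c m = 0))"

definition generic :: "'a set \<Rightarrow> nat \<Rightarrow> ('a \<Rightarrow> nat \<Rightarrow> real) \<Rightarrow> bool" where
  "generic V k p \<longleftrightarrow> alg_indep_rat (V \<times> {..<k}) (\<lambda>(v, j). p v j)"

text \<open>Entry of the row of the rigidity matrix R(G,p) for edge e = {u,v} in column (w,j):
  p(u)_j - p(v)_j if w = u, p(v)_j - p(u)_j if w = v, and 0 otherwise.\<close>
definition rig_entry :: "('a \<Rightarrow> nat \<Rightarrow> real) \<Rightarrow> 'a set \<Rightarrow> 'a \<Rightarrow> nat \<Rightarrow> real" where
  "rig_entry p e w j = (if w \<in> e then (\<Sum>x\<in>e - {w}. p w j - p x j) else 0)"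

definition rows_indep :: "'a set \<Rightarrow> nat \<Rightarrow> ('a \<Rightarrow> nat \<Rightarrow> real) \<Rightarrow> 'a set set \<Rightarrow> bool" where
  "rows_indep V k p F \<longleftrightarrow>
     (\<forall>c :: 'a set \<Rightarrow> real.
        (\<forall>w\<in>V. \<forall>j<k. (\<Sum>e\<in>F. c e * rig_entry p e w j) = 0) \<longrightarrow> (\<forall>e\<in>F. c e = 0))"

definition rig_indep :: "'a set \<Rightarrow> nat \<Rightarrow> 'a set set \<Rightarrow> bool" where
  "rig_indep V k F \<longleftrightarrow> (\<exists>p. generic V k p \<and> rows_indep V k p F)"

definition rig_circuit :: "'a set \<Rightarrow> 'a set set \<Rightarrow> nat \<Rightarrow> 'a set set \<Rightarrow> bool" where
  "rig_circuit V E k C \<longleftrightarrow> C \<subseteq> E \<and> \<not> rig_indep V k C \<and>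
     (\<forall>D. D \<subset> C \<longrightarrow> rig_indep V k D)"

definition M_connected :: "'a set \<Rightarrow> 'a set set \<Rightarrow> nat \<Rightarrow> bool" where
  "M_connected V E k \<longleftrightarrow>
     (\<forall>e\<in>E. \<forall>f\<in>E. e \<noteq> f \<longrightarrow> (\<exists>C. rig_circuit V E k C \<and> e \<in> C \<and> f \<in> C))"

end

theory Submission
  imports Defs "HOL-Combinatorics.Transposition"
begin

text \<open>
  A row dependency (stress) of a framework p in R^d satisfies one system of equations per
  coordinate. Hence the stresses in R^d are exactly the vectors that are stresses of every
  projection of p to d' coordinates, and all these projections are generic, so that they define
  the same matroid. If e and f lie in no common circuit of this matroid, it has a separator E1
  containing e but not f, and restricting to E1 maps the stresses of every projection to
  stresses. So it does the same for stresses in R^d, and no support-minimal one of these can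
  contain both e and f.
\<close>

section \<open>Circuits of a space of vectors\<close>

text \<open>\<open>S\<close> is to be read as the space of linear dependencies among rows indexed by
  \<open>E\<close>, so the matroid is given by dependencies alone. Its circuits are the minimal
  nonempty supports of vectors in \<open>S\<close>.\<close>

locale vector_matroid =
  fixes S :: "('e \<Rightarrow> real) set" and E :: "'e set"
  assumes finite_ground: "finite E"
    and support_ground: "c \<in> S \<Longrightarrow> x \<notin> E \<Longrightarrow> c x = 0"
    and zero_mem: "(\<lambda>x. 0) \<in> S"
    and lincomb_mem: "c \<in> S \<Longrightarrow> c' \<in> S \<Longrightarrow> (\<lambda>x. a * c x + b * c' x) \<in> S"
begin

definition supp :: "('e \<Rightarrow> real) \<Rightarrow> 'e set" where
  "supp c = {x. c x \<noteq> 0}"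

definition dependent :: "'e set \<Rightarrow> bool" where
  "dependent F \<longleftrightarrow> (\<exists>c\<in>S. supp c \<noteq> {} \<and> supp c \<subseteq> F)"

definition circuit :: "'e set \<Rightarrow> bool" where
  "circuit C \<longleftrightarrow> dependent C \<and> (\<forall>D. D \<subset> C \<longrightarrow> \<not> dependent D)"

lemma finite_supp: "c \<in> S \<Longrightarrow> finite (supp c)"
  using finite_subset[OF _ finite_ground, of "supp c"] support_ground
  by (auto simp: supp_def)

lemma circuit_vector:
  assumes "circuit C"
  obtains c where "c \<in> S" "supp c = C"
  using assms unfolding circuit_def dependent_def by (metis psubsetI subset_refl)

lemma finite_circuit: "circuit C \<Longrightarrow> finite C"
  by (metis circuit_vector finite_supp)

lemma circuit_subset_eq: "circuit C \<Longrightarrow> circuit D \<Longrightarrow> C \<subseteq> D \<Longrightarrow> C = D"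
  unfolding circuit_def by blast

section \<open>Circuit elimination by linear algebra\<close>

lemma cancel_coordinate:
  assumes "c \<in> S" "c' \<in> S" "c' h \<noteq> 0"
  obtains b where "b \<in> S" "b h = 0" "\<And>x. b x = c x - c h / c' h * c' x"
proof
  show "(\<lambda>x. 1 * c x + (- (c h / c' h)) * c' x) \<in> S"
    using lincomb_mem[OF assms(1,2)] .
qed (use assms in auto)

text \<open>If the support is not minimal, some \<open>c'\<close> has a strictly smaller one. Either
  it contains \<open>e\<close> and induction applies to \<open>c'\<close>, or subtracting a multiple
  of \<open>c'\<close> shrinks the support of \<open>c\<close> without changing the value at
  \<open>e\<close>.\<close>

lemma circuit_in_supp:
  assumes "c \<in> S" "e \<in> supp c"
  shows "\<exists>C. circuit C \<and> e \<in> C \<and> C \<subseteq> supp c"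
  using assms
proof (induction "card (supp c)" arbitrary: c rule: less_induct)
  case less
  show ?case
  proof (cases "circuit (supp c)")
    case True
    with less.prems show ?thesis by blast
  next
    case False
    have "dependent (supp c)"
      using less.prems by (auto simp: dependent_def)
    with False obtain c' where c': "c' \<in> S" "supp c' \<noteq> {}" "supp c' \<subset> supp c"
      unfolding circuit_def dependent_def by (meson order_le_less_trans)
    show ?thesis
    proof (cases "e \<in> supp c'")
      case True
      have "card (supp c') < card (supp c)"
        using c'(3) less.prems(1) by (simp add: finite_supp psubset_card_mono)
      from less.hyps[OF this c'(1) True] c'(3) show ?thesis by blast
    next
      case e: False
      from c'(2) obtain h where h: "c' h \<noteq> 0" by (auto simp: supp_def)
      obtain b where b: "b \<in> S" "b h = 0" "\<And>x. b x = c x - c h / c' h * c' x"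
        using cancel_coordinate[OF less.prems(1) c'(1) h] by blast
      have "supp b \<subseteq> supp c"
        using c'(3) by (fastforce simp: supp_def b(3))
      moreover have "h \<in> supp c - supp b"
        using h b(2) c'(3) by (auto simp: supp_def)
      ultimately have sub: "supp b \<subset> supp c" by blast
      have "e \<in> supp b"
        using e less.prems(2) by (auto simp: supp_def b(3))
      moreover have "card (supp b) < card (supp c)"
        using sub less.prems(1) by (simp add: finite_supp psubset_card_mono)
      ultimately show ?thesis using less.hyps[of b] b(1) sub by blast
    qed
  qed
qed

text \<open>The combination of the two circuit vectors that cancels \<open>g\<close> still has the
  value of \<open>c1\<close> at \<open>e\<close>, because \<open>c2\<close> vanishes there.\<close>

lemma strong_circuit_elimination:
  assumes "circuit C1" "circuit C2" "g \<in> C1" "g \<in> C2" "e \<in> C1" "e \<notin> C2"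
  shows "\<exists>C. circuit C \<and> e \<in> C \<and> C \<subseteq> C1 \<union> C2 - {g}"
proof -
  obtain c1 where c1: "c1 \<in> S" "supp c1 = C1" using assms(1) by (rule circuit_vector)
  obtain c2 where c2: "c2 \<in> S" "supp c2 = C2" using assms(2) by (rule circuit_vector)
  have "c2 g \<noteq> 0" using c2 assms by (auto simp: supp_def)
  then obtain b where b: "b \<in> S" "b g = 0" "\<And>x. b x = c1 x - c1 g / c2 g * c2 x"
    using cancel_coordinate[OF c1(1) c2(1)] by blast
  have "e \<in> supp b"
    using assms(5,6) c1 c2 by (auto simp: supp_def b(3))
  moreover have "supp b \<subseteq> C1 \<union> C2 - {g}"
    using b(2) c1(2) c2(2) by (auto simp: supp_def b(3))
  ultimately show ?thesis using circuit_in_supp[OF b(1)] by blast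
qed

text \<open>This makes lying in a common circuit a transitive relation. The induction replaces one
  or both circuits by eliminated ones that still meet but have a smaller union.\<close>

lemma common_circuit_of_meeting:
  assumes "circuit C1" "circuit C2" "e \<in> C1" "f \<in> C2" "C1 \<inter> C2 \<noteq> {}"
  shows "\<exists>C. circuit C \<and> e \<in> C \<and> f \<in> C"
  using assms
proof (induction "card (C1 \<union> C2)" arbitrary: C1 C2 rule: less_induct)
  case less
  show ?case
  proof (cases "e \<in> C2 \<or> f \<in> C1")
    case True
    with less.prems show ?thesis by blast
  next
    case False
    have smaller: "\<exists>C. circuit C \<and> e \<in> C \<and> f \<in> C"
      if "circuit D1" "circuit D2" "e \<in> D1" "f \<in> D2" "D1 \<inter> D2 \<noteq> {}" "D1 \<union> D2 \<subset> C1 \<union> C2"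
      for D1 D2
      using less.hyps[OF psubset_card_mono that(1-5)] that(6) less.prems(1,2)
      by (simp add: finite_circuit)
    obtain g where g: "g \<in> C1" "g \<in> C2" using less.prems(5) by blast
    obtain C3 where C3: "circuit C3" "e \<in> C3" "C3 \<subseteq> C1 \<union> C2 - {g}"
      using strong_circuit_elimination[of C1 C2 g e] less.prems False g by blast
    obtain C4 where C4: "circuit C4" "f \<in> C4" "C4 \<subseteq> C2 \<union> C1 - {g}"
      using strong_circuit_elimination[of C2 C1 g f] less.prems False g by blast
    \<comment> \<open>Inclusion would force equality by minimality, yet \<open>g\<close> is in
      \<open>C1\<close> and not in \<open>C3\<close>.\<close>
    have "\<not> C3 \<subseteq> C1" using circuit_subset_eq[OF C3(1) less.prems(1)] C3(3) g by blast
    then have meet3: "C3 \<inter> (C2 - C1) \<noteq> {}" using C3(3) by blast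
    have "\<not> C4 \<subseteq> C2" using circuit_subset_eq[OF C4(1) less.prems(2)] C4(3) g by blast
    then have meet4: "C4 \<inter> (C1 - C2) \<noteq> {}" using C4(3) by blast
    show ?thesis
    proof (cases "C1 \<union> C4 \<subset> C1 \<union> C2")
      case True
      then show ?thesis using smaller[of C1 C4] less.prems C4 meet4 by blast
    next
      case False
      \<comment> \<open>Here \<open>C1\<close> and \<open>C4\<close> together already fill
        \<open>C1 \<union> C2\<close>. So \<open>C4\<close> meets \<open>C3\<close>, and the pair
        \<open>C3\<close>, \<open>C4\<close> has a smaller union because both avoid
        \<open>g\<close>.\<close>
      then have "C2 - C1 \<subseteq> C4" using C4(3) by blast
      then have "C3 \<inter> C4 \<noteq> {}" using meet3 by blast
      moreover have "C3 \<union> C4 \<subset> C1 \<union> C2" using C3(3) C4(3) g by blast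
      ultimately show ?thesis using smaller[of C3 C4] C3 C4 by blast
    qed
  qed
qed

text \<open>The connected component of \<open>e\<close> in the matroid. The disjunct
  \<open>f = e\<close> covers an element that lies in no circuit.\<close>

definition component :: "'e \<Rightarrow> 'e set" where
  "component e = {f. f = e \<or> (\<exists>C. circuit C \<and> e \<in> C \<and> f \<in> C)}"

lemma circuit_subset_component:
  assumes "circuit C" "C \<inter> component e \<noteq> {}"
  shows "C \<subseteq> component e"
proof
  fix g assume g: "g \<in> C"
  show "g \<in> component e"
  proof (cases "e \<in> C")
    case True
    with assms(1) g show ?thesis by (auto simp: component_def)
  next
    case False
    with assms(2) obtain f C' where "f \<in> C" "circuit C'" "e \<in> C'" "f \<in> C'"
      by (auto simp: component_def)
    then show ?thesis
      using common_circuit_of_meeting[of C' C e g] assms(1) g by (auto simp: component_def)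
  qed
qed

text \<open>Components are separators: \<open>S\<close> splits along them. Peeling off circuit
  vectors one at a time reduces the claim to a single circuit vector, which is supported either
  inside the component or outside it.\<close>

lemma restrict_component_mem:
  assumes "c \<in> S"
  shows "(\<lambda>x. if x \<in> component e then c x else 0) \<in> S"
  using assms
proof (induction "card (supp c)" arbitrary: c rule: less_induct)
  case less
  show ?case
  proof (cases "supp c = {}")
    case True
    then have "(\<lambda>x. if x \<in> component e then c x else 0) = (\<lambda>x. 0)"
      by (auto simp: supp_def)
    then show ?thesis using zero_mem by simp
  next
    case False
    then obtain h where h: "h \<in> supp c" by blast
    then obtain C where C: "circuit C" "h \<in> C" "C \<subseteq> supp c"
      using circuit_in_supp less.prems by blast
    obtain c' where c': "c' \<in> S" "supp c' = C" using C(1) by (rule circuit_vector)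
    have h': "c' h \<noteq> 0" using C(2) c'(2) by (auto simp: supp_def)
    obtain b where b: "b \<in> S" "b h = 0" "\<And>x. b x = c x - c h / c' h * c' x"
      using cancel_coordinate[OF less.prems c'(1) h'] by blast
    have "supp b \<subseteq> supp c - {h}"
      using C(3) b(2) c'(2) by (fastforce simp: supp_def b(3))
    then have "card (supp b) < card (supp c)"
      using h less.prems by (intro psubset_card_mono) (auto simp: finite_supp)
    then have 1: "(\<lambda>x. if x \<in> component e then b x else 0) \<in> S"
      using less.hyps b(1) by blast
    have "C \<subseteq> component e \<or> C \<inter> component e = {}"
      using circuit_subset_component[OF C(1)] by blast
    then have "(\<lambda>x. if x \<in> component e then c' x else 0) = c' \<or>
        (\<lambda>x. if x \<in> component e then c' x else 0) = (\<lambda>x. 0)"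
      using c'(2) by (fastforce simp: supp_def fun_eq_iff)
    then have 2: "(\<lambda>x. if x \<in> component e then c' x else 0) \<in> S"
      using c'(1) zero_mem by auto
    have eq: "(\<lambda>x. if x \<in> component e then c x else 0) =
      (\<lambda>x. 1 * (if x \<in> component e then b x else 0)
          + (c h / c' h) * (if x \<in> component e then c' x else 0))"
      by (auto simp: b(3))
    show ?thesis unfolding eq by (rule lincomb_mem[OF 1 2])
  qed
qed

end

section \<open>Rational polynomial functions and generic independence\<close>

text \<open>The encoding by exponent vectors repeats that of \<open>alg_indep_rat\<close>, so
  genericity applies directly to a representation of \<open>f\<close>.\<close>

definition rat_poly_fun :: "'b set \<Rightarrow> (('b \<Rightarrow> real) \<Rightarrow> real) \<Rightarrow> bool" where
  "rat_poly_fun I f \<longleftrightarrow> (\<exists>M (c :: ('b \<Rightarrow> nat) \<Rightarrow> rat). finite M \<and> (\<forall>m\<in>M. \<forall>i. i \<notin> I \<longrightarrow> m i = 0) \<and>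
     f = (\<lambda>x. \<Sum>m\<in>M. of_rat (c m) * (\<Prod>i\<in>I. x i ^ m i)))"

text \<open>Allowing repeated monomials makes sums and products of polynomials easy to represent.\<close>

lemma rat_poly_fun_indexed_sum:
  fixes a :: "'t \<Rightarrow> rat" and m :: "'t \<Rightarrow> 'b \<Rightarrow> nat"
  assumes "finite T" "\<And>t i. t \<in> T \<Longrightarrow> i \<notin> I \<Longrightarrow> m t i = 0"
  shows "rat_poly_fun I (\<lambda>x. \<Sum>t\<in>T. of_rat (a t) * (\<Prod>i\<in>I. x i ^ m t i))"
  unfolding rat_poly_fun_def
proof (intro exI conjI ext)
  fix x :: "'b \<Rightarrow> real"
  have "(\<Sum>t\<in>T. of_rat (a t) * (\<Prod>i\<in>I. x i ^ m t i)) =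
      (\<Sum>n\<in>m ` T. \<Sum>t\<in>{t\<in>T. m t = n}. of_rat (a t) * (\<Prod>i\<in>I. x i ^ m t i))"
    by (rule sum.image_gen) (rule assms)
  also have "\<dots> = (\<Sum>n\<in>m ` T. of_rat (\<Sum>t\<in>{t\<in>T. m t = n}. a t) * (\<Prod>i\<in>I. x i ^ n i))"
    by (intro sum.cong refl) (simp add: of_rat_sum sum_distrib_right)
  finally show "(\<Sum>t\<in>T. of_rat (a t) * (\<Prod>i\<in>I. x i ^ m t i)) =
      (\<Sum>n\<in>m ` T. of_rat (\<Sum>t\<in>{t\<in>T. m t = n}. a t) * (\<Prod>i\<in>I. x i ^ n i))" .
qed (use assms in auto)

lemma rat_poly_fun_zero: "rat_poly_fun I (\<lambda>x. 0)"
  using rat_poly_fun_indexed_sum[of "{}"] by simp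

lemma rat_poly_fun_var:
  assumes "finite I" "i \<in> I"
  shows "rat_poly_fun I (\<lambda>x. x i)"
proof -
  have "(\<Prod>j\<in>I. x j ^ (if j = i then 1 else 0)) = x i" for x :: "'a \<Rightarrow> real"
    using assms by (simp add: if_distrib[of "(^) _"] prod.delta cong: if_cong)
  moreover have "rat_poly_fun I
      (\<lambda>x. \<Sum>t\<in>{()}. of_rat 1 * (\<Prod>j\<in>I. x j ^ (if j = i then 1 else 0)))"
    using assms by (intro rat_poly_fun_indexed_sum) auto
  ultimately show ?thesis by simp
qed

lemma rat_poly_fun_mult:
  assumes "rat_poly_fun I f" "rat_poly_fun I g"
  shows "rat_poly_fun I (\<lambda>x. f x * g x)"
proof -
  obtain M c where M: "finite M" "\<forall>m\<in>M. \<forall>i. i \<notin> I \<longrightarrow> m i = 0"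
    "f = (\<lambda>x. \<Sum>m\<in>M. of_rat (c m) * (\<Prod>i\<in>I. x i ^ m i))"
    using assms(1) unfolding rat_poly_fun_def by blast
  obtain N d where N: "finite N" "\<forall>m\<in>N. \<forall>i. i \<notin> I \<longrightarrow> m i = 0"
    "g = (\<lambda>x. \<Sum>m\<in>N. of_rat (d m) * (\<Prod>i\<in>I. x i ^ m i))"
    using assms(2) unfolding rat_poly_fun_def by blast
  have "f x * g x = (\<Sum>t\<in>M \<times> N. of_rat (c (fst t) * d (snd t)) *
      (\<Prod>i\<in>I. x i ^ (fst t i + snd t i)))" for x
    unfolding M(3) N(3) sum_product sum.cartesian_product
    by (intro sum.cong) (auto simp: of_rat_mult power_add prod.distrib)
  moreover have "rat_poly_fun I (\<lambda>x. \<Sum>t\<in>M \<times> N. of_rat (c (fst t) * d (snd t)) *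
      (\<Prod>i\<in>I. x i ^ (fst t i + snd t i)))"
    using M(1,2) N(1,2) by (intro rat_poly_fun_indexed_sum) auto
  ultimately show ?thesis by presburger
qed

lemma rat_poly_fun_scale_add:
  assumes "rat_poly_fun I f" "rat_poly_fun I g"
  shows "rat_poly_fun I (\<lambda>x. f x + of_rat q * g x)"
proof -
  obtain M c where M: "finite M" "\<forall>m\<in>M. \<forall>i. i \<notin> I \<longrightarrow> m i = 0"
    "f = (\<lambda>x. \<Sum>m\<in>M. of_rat (c m) * (\<Prod>i\<in>I. x i ^ m i))"
    using assms(1) unfolding rat_poly_fun_def by blast
  obtain N d where N: "finite N" "\<forall>m\<in>N. \<forall>i. i \<notin> I \<longrightarrow> m i = 0"
    "g = (\<lambda>x. \<Sum>m\<in>N. of_rat (d m) * (\<Prod>i\<in>I. x i ^ m i))"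
    using assms(2) unfolding rat_poly_fun_def by blast
  have "f x + of_rat q * g x = (\<Sum>t\<in>M <+> N. of_rat (case_sum c (\<lambda>n. q * d n) t) *
      (\<Prod>i\<in>I. x i ^ case_sum id id t i))" for x
    unfolding M(3) N(3) using M(1) N(1)
    by (simp add: sum.Plus sum_distrib_left of_rat_mult mult.assoc)
  moreover have "rat_poly_fun I (\<lambda>x. \<Sum>t\<in>M <+> N. of_rat (case_sum c (\<lambda>n. q * d n) t) *
      (\<Prod>i\<in>I. x i ^ case_sum id id t i))"
    using M(1,2) N(1,2) by (intro rat_poly_fun_indexed_sum) auto
  ultimately show ?thesis by presburger
qed

lemma rat_poly_fun_add:
  "rat_poly_fun I f \<Longrightarrow> rat_poly_fun I g \<Longrightarrow> rat_poly_fun I (\<lambda>x. f x + g x)"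
  using rat_poly_fun_scale_add[of I f g 1] by simp

lemma rat_poly_fun_diff:
  "rat_poly_fun I f \<Longrightarrow> rat_poly_fun I g \<Longrightarrow> rat_poly_fun I (\<lambda>x. f x - g x)"
  using rat_poly_fun_scale_add[of I f g "-1"] by (simp add: of_rat_minus)

lemma rat_poly_fun_sum:
  "(\<And>t. t \<in> T \<Longrightarrow> rat_poly_fun I (f t)) \<Longrightarrow> rat_poly_fun I (\<lambda>x. \<Sum>t\<in>T. f t x)"
  by (induction T rule: infinite_finite_induct) (auto intro: rat_poly_fun_zero rat_poly_fun_add)

text \<open>Vanishing at the algebraically independent \<open>y\<close> kills every coefficient,
  hence the whole function. The point \<open>x\<close> is arbitrary.\<close>

lemma rat_poly_fun_nonzero_generic:
  assumes "rat_poly_fun I f" "alg_indep_rat I y" "f x \<noteq> 0"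
  shows "f y \<noteq> 0"
proof
  assume y: "f y = 0"
  obtain M c where M: "finite M" "\<forall>m\<in>M. \<forall>i. i \<notin> I \<longrightarrow> m i = 0"
    "f = (\<lambda>x. \<Sum>m\<in>M. of_rat (c m) * (\<Prod>i\<in>I. x i ^ m i))"
    using assms(1) unfolding rat_poly_fun_def by blast
  then have "\<forall>m\<in>M. c m = 0"
    using assms(2) y unfolding alg_indep_rat_def by simp
  then have "f x = 0" by (simp add: M(3))
  with assms(3) show False by contradiction
qed

section \<open>Row independence of matrices with polynomial entries\<close>

definition matrix_rows_indep :: "'r set \<Rightarrow> 'c set \<Rightarrow> ('r \<Rightarrow> 'c \<Rightarrow> real) \<Rightarrow> bool" where
  "matrix_rows_indep F K A \<longleftrightarrow>
     (\<forall>c. (\<forall>k\<in>K. (\<Sum>r\<in>F. c r * A r k) = 0) \<longrightarrow> (\<forall>r\<in>F. c r = 0))"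

text \<open>One step of Gaussian elimination with pivot \<open>A r k\<close>. It avoids division, so
  polynomial entries remain polynomial.\<close>

lemma matrix_rows_indep_eliminate:
  assumes "finite F" "r \<notin> F" "k \<in> K" and pivot: "A r k \<noteq> 0"
  shows "matrix_rows_indep (insert r F) K A \<longleftrightarrow>
    matrix_rows_indep F K (\<lambda>s l. A r k * A s l - A s k * A r l)"
    (is "_ \<longleftrightarrow> matrix_rows_indep F K ?B")
proof
  assume L: "matrix_rows_indep (insert r F) K A"
  show "matrix_rows_indep F K ?B"
    unfolding matrix_rows_indep_def
  proof (intro allI impI)
    fix c assume c: "\<forall>l\<in>K. (\<Sum>s\<in>F. c s * ?B s l) = 0"
    \<comment> \<open>Scaling by the pivot undoes the multiplication in \<open>?B\<close>; the
      coefficient of row \<open>r\<close> collects the multiples of that row which were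
      subtracted.\<close>
    define c' where "c' s = (if s = r then - (\<Sum>s\<in>F. c s * A s k) else A r k * c s)" for s
    have "(\<Sum>s\<in>insert r F. c' s * A s l) = 0" if "l \<in> K" for l
    proof -
      have "(\<Sum>s\<in>F. c' s * A s l) = (\<Sum>s\<in>F. A r k * c s * A s l)"
        using assms(2) by (intro sum.cong) (auto simp: c'_def)
      then have "(\<Sum>s\<in>insert r F. c' s * A s l) = (\<Sum>s\<in>F. c s * ?B s l)"
        using assms(1,2)
        by (simp add: c'_def sum_distrib_left sum_distrib_right sum_subtractf algebra_simps)
      with c that show ?thesis by simp
    qed
    then have "\<forall>s\<in>insert r F. c' s = 0"
      using L unfolding matrix_rows_indep_def by blast
    then show "\<forall>s\<in>F. c s = 0"
      using pivot assms(2) by (metis c'_def insertCI mult_eq_0_iff)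
  qed
next
  assume R: "matrix_rows_indep F K ?B"
  show "matrix_rows_indep (insert r F) K A"
    unfolding matrix_rows_indep_def
  proof (intro allI impI)
    fix c assume c: "\<forall>l\<in>K. (\<Sum>s\<in>insert r F. c s * A s l) = 0"
    have eq: "(\<Sum>s\<in>F. c s * A s l) = - (c r * A r l)" if "l \<in> K" for l
      using bspec[OF c that] assms(1,2) by simp
    have "(\<Sum>s\<in>F. c s * ?B s l) = 0" if "l \<in> K" for l
    proof -
      have "(\<Sum>s\<in>F. c s * ?B s l) =
          A r k * (\<Sum>s\<in>F. c s * A s l) - (\<Sum>s\<in>F. c s * A s k) * A r l"
        by (simp add: sum_distrib_left sum_distrib_right sum_subtractf algebra_simps)
      then show ?thesis by (simp add: eq that assms(3))
    qed
    then have F: "\<forall>s\<in>F. c s = 0" using R unfolding matrix_rows_indep_def by blast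
    then have "c r * A r k = 0" using eq[OF assms(3)] by simp
    with F pivot show "\<forall>s\<in>insert r F. c s = 0" by simp
  qed
qed

text \<open>Row independence at any point passes to a generic one. A pivot that is nonzero at
  \<open>x\<close> is nonzero at \<open>y\<close>, so the same elimination step works at both points
  and leaves a polynomial matrix with one row fewer.\<close>

lemma matrix_rows_indep_generic:
  fixes A :: "'r \<Rightarrow> 'c \<Rightarrow> ('b \<Rightarrow> real) \<Rightarrow> real"
  assumes "finite F" "\<And>r k. r \<in> F \<Longrightarrow> k \<in> K \<Longrightarrow> rat_poly_fun I (A r k)"
    and "alg_indep_rat I y" "matrix_rows_indep F K (\<lambda>r k. A r k x)"
  shows "matrix_rows_indep F K (\<lambda>r k. A r k y)"
  using assms
proof (induction F arbitrary: A rule: finite_induct)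
  case empty
  then show ?case by (simp add: matrix_rows_indep_def)
next
  case (insert r F)
  \<comment> \<open>If row \<open>r\<close> were zero at \<open>x\<close>, the indicator of
    \<open>r\<close> would be a nontrivial dependency.\<close>
  have "\<exists>k\<in>K. A r k x \<noteq> 0"
  proof (rule ccontr)
    assume *: "\<not> (\<exists>k\<in>K. A r k x \<noteq> 0)"
    have "(\<Sum>s\<in>insert r F. (if s = r then 1 else 0) * A s k x) = 0" if "k \<in> K" for k
      using * that by (intro sum.neutral) auto
    then show False
      using insert.prems(3)[unfolded matrix_rows_indep_def, rule_format,
          of "\<lambda>s. if s = r then 1 else 0" r] by simp
  qed
  then obtain k where k: "k \<in> K" "A r k x \<noteq> 0" by blast
  have k': "A r k y \<noteq> 0"
    using rat_poly_fun_nonzero_generic[of I "A r k" y x] insert.prems(1,2) k by simp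
  let ?B = "\<lambda>s l z. A r k z * A s l z - A s k z * A r l z"
  note eliminate = matrix_rows_indep_eliminate[where A = "\<lambda>r k. A r k z" for z,
      OF insert.hyps(1,2) k(1)]
  have "rat_poly_fun I (?B s l)" if "s \<in> F" "l \<in> K" for s l
    using that k(1) by (intro rat_poly_fun_diff rat_poly_fun_mult insert.prems(1)) auto
  moreover have "matrix_rows_indep F K (\<lambda>s l. ?B s l x)"
    using eliminate[of x, OF k(2)] insert.prems(3) by simp
  ultimately have "matrix_rows_indep F K (\<lambda>s l. ?B s l y)"
    using insert.IH[of ?B] insert.prems(2) by simp
  then show ?case
    using eliminate[of y, OF k'] by simp
qed

text \<open>A relation among the selected variables becomes a relation among the original ones when
  exponents are moved along \<open>g\<close>.\<close>

lemma alg_indep_rat_reindex: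
  fixes g :: "'b \<Rightarrow> 'c"
  assumes "alg_indep_rat I x" "finite I" "inj_on g J" "g ` J \<subseteq> I"
  shows "alg_indep_rat J (\<lambda>j. x (g j))"
  unfolding alg_indep_rat_def
proof (intro allI impI)
  fix M :: "('b \<Rightarrow> nat) set" and c :: "('b \<Rightarrow> nat) \<Rightarrow> rat"
  assume M: "finite M" "\<forall>m\<in>M. \<forall>i. i \<notin> J \<longrightarrow> m i = 0"
    and zero: "(\<Sum>m\<in>M. of_rat (c m) * (\<Prod>i\<in>J. x (g i) ^ m i)) = 0"
  \<comment> \<open>\<open>push\<close> transports exponents along \<open>g\<close> and puts 0
    elsewhere; \<open>pull\<close> inverts it on \<open>M\<close> and so carries the coefficients
    over.\<close>
  define push :: "('b \<Rightarrow> nat) \<Rightarrow> 'c \<Rightarrow> nat"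
    where "push m = (\<lambda>i. if i \<in> g ` J then m (inv_into J g i) else 0)" for m
  define pull :: "('c \<Rightarrow> nat) \<Rightarrow> 'b \<Rightarrow> nat"
    where "pull n = (\<lambda>j. if j \<in> J then n (g j) else 0)" for n
  have pull_push: "pull (push m) = m" if "m \<in> M" for m
    using that M(2) assms(3) by (auto simp: push_def pull_def fun_eq_iff)
  then have inj: "inj_on push M" by (auto intro: inj_on_inverseI)
  have prod_eq: "(\<Prod>i\<in>I. x i ^ push m i) = (\<Prod>j\<in>J. x (g j) ^ m j)" for m
  proof -
    have "(\<Prod>i\<in>I. x i ^ push m i) = (\<Prod>i\<in>g ` J. x i ^ push m i)"
      using assms(2,4) by (intro prod.mono_neutral_right) (auto simp: push_def)
    also have "\<dots> = (\<Prod>j\<in>J. x (g j) ^ m j)"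
      using assms(3) by (simp add: prod.reindex push_def)
    finally show ?thesis .
  qed
  have "(\<Sum>n\<in>push ` M. of_rat (c (pull n)) * (\<Prod>i\<in>I. x i ^ n i)) = 0"
    using zero by (simp add: sum.reindex[OF inj] prod_eq pull_push)
  moreover have "\<forall>n\<in>push ` M. \<forall>i. i \<notin> I \<longrightarrow> n i = 0"
    using assms(4) by (auto simp: push_def)
  ultimately have "\<forall>n\<in>push ` M. c (pull n) = 0"
    using assms(1) M(1) unfolding alg_indep_rat_def
    by (elim allE[of _ "push ` M"] allE[of _ "\<lambda>n. c (pull n)"]) auto
  then show "\<forall>m\<in>M. c m = 0" by (simp add: pull_push)
qed

section \<open>The rigidity matroid of a generic framework\<close>

lemma generic_select_coordinates:
  assumes "finite V" "generic V k p" "inj_on \<sigma> {..<k'}" "\<sigma> ` {..<k'} \<subseteq> {..<k}"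
  shows "generic V k' (\<lambda>v j. p v (\<sigma> j))"
proof -
  have "alg_indep_rat (V \<times> {..<k'}) (\<lambda>t. (\<lambda>(v, j). p v j) (map_prod id \<sigma> t))"
  proof (rule alg_indep_rat_reindex[where x = "\<lambda>(v, j). p v j" and g = "map_prod id \<sigma>"])
    show "alg_indep_rat (V \<times> {..<k}) (\<lambda>(v, j). p v j)"
      using assms(2) unfolding generic_def .
  qed (use assms in \<open>auto simp: inj_on_def\<close>)
  then show ?thesis
    by (simp add: generic_def map_prod_def case_prod_beta')
qed

lemma simple_graph_edge_subset: "simple_graph V E \<Longrightarrow> e \<in> E \<Longrightarrow> e \<subseteq> V"
  by (force simp: simple_graph_def)

lemma simple_graph_finite_edges: "simple_graph V E \<Longrightarrow> finite E"
  by (rule finite_subset[of _ "Pow V"])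
    (auto dest: simple_graph_edge_subset simp: simple_graph_def)

text \<open>The choice of generic framework is immaterial: entries of the rigidity matrix are
  rational polynomials in the coordinates, so independence at one framework holds at every generic
  one.\<close>

lemma rig_indep_iff_rows_indep:
  assumes "simple_graph V E" "F \<subseteq> E" "generic V k p"
  shows "rig_indep V k F \<longleftrightarrow> rows_indep V k p F"
proof
  assume "rig_indep V k F"
  then obtain q where q: "rows_indep V k q F" unfolding rig_indep_def by blast
  let ?I = "V \<times> {..<k}"
  define A where "A e = (\<lambda>(w, j) x. rig_entry (\<lambda>v j. x (v, j)) e w j)"
    for e :: "'a set"
  have rows: "rows_indep V k p F \<longleftrightarrow> matrix_rows_indep F ?I (\<lambda>e t. A e t (\<lambda>(v, j). p v j))"
    for p :: "'a \<Rightarrow> nat \<Rightarrow> real"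
    by (auto simp: rows_indep_def matrix_rows_indep_def A_def)
  have "rat_poly_fun ?I (A e t)" if eF: "e \<in> F" and tI: "t \<in> ?I" for e t
  proof -
    obtain w j where t: "t = (w, j)" "w \<in> V" "j < k" using tI by auto
    have e: "e \<subseteq> V" using simple_graph_edge_subset assms(1,2) eF by blast
    have fin: "finite ?I" using assms(1) by (simp add: simple_graph_def)
    have "rat_poly_fun ?I (\<lambda>x. \<Sum>v\<in>e - {w}. x (w, j) - x (v, j))"
      using t e by (intro rat_poly_fun_sum rat_poly_fun_diff rat_poly_fun_var fin) auto
    then show ?thesis
      by (cases "w \<in> e") (simp_all add: A_def t(1) rig_entry_def rat_poly_fun_zero)
  qed
  moreover have "finite F"
    using assms(1,2) simple_graph_finite_edges finite_subset by blast
  ultimately show "rows_indep V k p F"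
    using matrix_rows_indep_generic[of F ?I ?I A] assms(3) q
    unfolding rows generic_def by blast
qed (use assms(3) in \<open>auto simp: rig_indep_def\<close>)

text \<open>The left kernel of the rigidity matrix, with vectors extended by zero outside
  \<open>E\<close> to fit \<open>vector_matroid\<close>.\<close>

definition stresses :: "'a set \<Rightarrow> 'a set set \<Rightarrow> nat \<Rightarrow> ('a \<Rightarrow> nat \<Rightarrow> real) \<Rightarrow> ('a set \<Rightarrow> real) set" where
  "stresses V E k p = {c. (\<forall>e. e \<notin> E \<longrightarrow> c e = 0) \<and>
     (\<forall>w\<in>V. \<forall>j<k. (\<Sum>e\<in>E. c e * rig_entry p e w j) = 0)}"

lemma vector_matroid_stresses:
  assumes "finite E"
  shows "vector_matroid (stresses V E k p) E"
proof
  fix c c' :: "'a set \<Rightarrow> real" and a b :: real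
  assume cc': "c \<in> stresses V E k p" "c' \<in> stresses V E k p"
  have "(\<Sum>e\<in>E. (a * c e + b * c' e) * rig_entry p e w j) =
      a * (\<Sum>e\<in>E. c e * rig_entry p e w j) + b * (\<Sum>e\<in>E. c' e * rig_entry p e w j)" for w j
    by (simp add: sum_distrib_left sum.distrib algebra_simps)
  with cc' show "(\<lambda>x. a * c x + b * c' x) \<in> stresses V E k p"
    by (simp add: stresses_def)
qed (use assms in \<open>auto simp: stresses_def\<close>)

text \<open>Extension by zero turns a dependency among the rows in \<open>F\<close> into a stress
  supported in \<open>F\<close>.\<close>

lemma rows_indep_iff_not_dependent:
  assumes "finite E" "F \<subseteq> E"
  shows "rows_indep V k p F \<longleftrightarrow> \<not> vector_matroid.dependent (stresses V E k p) F"
proof -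
  interpret vector_matroid "stresses V E k p" E by (rule vector_matroid_stresses) fact
  have sum_eq: "(\<Sum>e\<in>E. c e * rig_entry p e w j) = (\<Sum>e\<in>F. c e * rig_entry p e w j)"
    if "supp c \<subseteq> F" for c w j
    using assms that by (intro sum.mono_neutral_right) (auto simp: supp_def)
  show ?thesis
  proof
    assume indep: "rows_indep V k p F"
    show "\<not> dependent F"
    proof
      assume "dependent F"
      then obtain c where c: "c \<in> stresses V E k p" "supp c \<noteq> {}" "supp c \<subseteq> F"
        unfolding dependent_def by blast
      then have "\<forall>w\<in>V. \<forall>j<k. (\<Sum>e\<in>F. c e * rig_entry p e w j) = 0"
        by (simp add: stresses_def sum_eq)
      with indep have "\<forall>e\<in>F. c e = 0" unfolding rows_indep_def by blast
      with c show False by (auto simp: supp_def)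
    qed
  next
    assume indep: "\<not> dependent F"
    show "rows_indep V k p F"
      unfolding rows_indep_def
    proof (intro allI impI)
      fix c assume c: "\<forall>w\<in>V. \<forall>j<k. (\<Sum>e\<in>F. c e * rig_entry p e w j) = 0"
      define c' where "c' e = (if e \<in> F then c e else 0)" for e
      have sub: "supp c' \<subseteq> F" by (auto simp: supp_def c'_def)
      have "(\<Sum>e\<in>E. c' e * rig_entry p e w j) = (\<Sum>e\<in>F. c e * rig_entry p e w j)" for w j
        unfolding sum_eq[OF sub] by (simp add: c'_def)
      then have "c' \<in> stresses V E k p"
        using c assms(2) by (auto simp: stresses_def c'_def)
      with indep sub have "supp c' = {}" unfolding dependent_def by blast
      then show "\<forall>e\<in>F. c e = 0" by (auto simp: supp_def c'_def split: if_splits)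
    qed
  qed
qed

text \<open>Since \<open>p\<close> may be any generic framework, the stress spaces of all
  projections share the same circuits.\<close>

lemma rig_circuit_iff_circuit:
  assumes "simple_graph V E" "generic V k p"
  shows "rig_circuit V E k C \<longleftrightarrow> vector_matroid.circuit (stresses V E k p) C"
proof -
  have fin: "finite E" using assms(1) by (rule simple_graph_finite_edges)
  interpret vector_matroid "stresses V E k p" E by (rule vector_matroid_stresses) fact
  have indep: "rig_indep V k F \<longleftrightarrow> \<not> dependent F" if "F \<subseteq> E" for F
    using that assms fin by (simp add: rig_indep_iff_rows_indep rows_indep_iff_not_dependent)
  have "C \<subseteq> E" if "circuit C"
  proof -
    from that obtain c where "c \<in> stresses V E k p" "supp c = C" by (rule circuit_vector)
    then show ?thesis using support_ground by (auto simp: supp_def)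
  qed
  then show ?thesis
    unfolding rig_circuit_def circuit_def
    by (metis indep psubset_imp_subset subset_trans)
qed

text \<open>The equations of the projected framework are among those of \<open>p\<close>.\<close>

lemma stresses_select_coordinates:
  assumes "\<sigma> ` {..<k'} \<subseteq> {..<k}" "c \<in> stresses V E k p"
  shows "c \<in> stresses V E k' (\<lambda>v j. p v (\<sigma> j))"
proof -
  have "rig_entry (\<lambda>v j. p v (\<sigma> j)) e w j = rig_entry p e w (\<sigma> j)" for e w j
    by (simp add: rig_entry_def)
  with assms show ?thesis by (auto simp: stresses_def)
qed

section \<open>Passage from dimension \<open>d\<close> to dimension \<open>d'\<close>\<close>

theorem theorem5p1:
  fixes V :: "'a set" and E :: "'a set set" and d d' :: nat
  assumes "simple_graph V E"
    and "M_connected V E d"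
    and "1 \<le> d'" and "d' \<le> d"
  shows "M_connected V E d'"
proof (rule ccontr)
  assume "\<not> M_connected V E d'"
  then obtain e f where ef: "e \<in> E" "f \<in> E" "e \<noteq> f"
    and none: "\<And>C. rig_circuit V E d' C \<Longrightarrow> e \<in> C \<Longrightarrow> f \<notin> C"
    unfolding M_connected_def by blast
  obtain C where C: "rig_circuit V E d C" "e \<in> C" "f \<in> C"
    using assms(2) ef unfolding M_connected_def by blast
  \<comment> \<open>A generic framework comes from the existential in \<open>rig_indep\<close>,
    applied to a proper subset of the circuit.\<close>
  have "{e} \<subset> C" using C ef(3) by blast
  then have "rig_indep V d {e}" using C(1) unfolding rig_circuit_def by blast
  then obtain p where p: "generic V d p" unfolding rig_indep_def by blast
  have fin: "finite E" "finite V"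
    using assms(1) simple_graph_finite_edges by (auto simp: simple_graph_def)
  interpret D: vector_matroid "stresses V E d p" E by (rule vector_matroid_stresses) fact
  have circ: "D.circuit C" using C(1) rig_circuit_iff_circuit assms(1) p by blast
  then obtain c where c: "c \<in> stresses V E d p" "D.supp c = C" by (rule D.circuit_vector)
  \<comment> \<open>Defined by \<open>rig_circuit\<close>, not by the stresses of one projection, so
    that the same set serves for every coordinate \<open>j\<close> below.\<close>
  define E1 where "E1 = {g. g = e \<or> (\<exists>C. rig_circuit V E d' C \<and> e \<in> C \<and> g \<in> C)}"
  have f: "f \<notin> E1" using ef(3) none by (auto simp: E1_def)
  let ?c = "\<lambda>x. if x \<in> E1 then c x else 0"
  have "(\<Sum>g\<in>E. ?c g * rig_entry p g w j) = 0" if "w \<in> V" "j < d" for w j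
  proof -
    \<comment> \<open>The swap moves coordinate \<open>j\<close> to position 0, which survives the
      projection because \<open>1 \<le> d'\<close>.\<close>
    let ?\<sigma> = "transpose 0 j"
    let ?q = "\<lambda>v i. p v (?\<sigma> i)"
    have \<sigma>: "?\<sigma> ` {..<d'} \<subseteq> {..<d}"
      using that(2) assms(4) by (auto simp: transpose_def)
    have q: "generic V d' ?q"
      using generic_select_coordinates[OF fin(2) p _ \<sigma>] by simp
    interpret D': vector_matroid "stresses V E d' ?q" E by (rule vector_matroid_stresses) fact
    have "E1 = D'.component e"
      by (simp add: E1_def D'.component_def rig_circuit_iff_circuit[OF assms(1) q])
    then have "?c \<in> stresses V E d' ?q"
      using D'.restrict_component_mem stresses_select_coordinates[OF \<sigma> c(1)] by simp
    then have "(\<Sum>g\<in>E. ?c g * rig_entry ?q g w 0) = 0"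
      using that(1) assms(3) unfolding stresses_def by auto
    moreover have "rig_entry ?q g w 0 = rig_entry p g w j" for g
      by (simp add: rig_entry_def)
    ultimately show ?thesis by simp
  qed
  \<comment> \<open>All coordinate equations now hold. The restricted stress is nonzero at
    \<open>e\<close> and zero at \<open>f\<close>, which contradicts the minimality of
    \<open>C\<close>.\<close>
  then have "?c \<in> stresses V E d p"
    using c(1) by (auto simp: stresses_def)
  moreover have "e \<in> D.supp ?c" using C(2) c(2) by (auto simp: D.supp_def E1_def)
  moreover have "D.supp ?c \<subseteq> C - {f}" using c(2) f by (auto simp: D.supp_def)
  ultimately have "D.dependent (C - {f})" unfolding D.dependent_def by blast
  moreover have "C - {f} \<subset> C" using C(3) by blast
  ultimately show False using circ unfolding D.circuit_def by blast
qed

end
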